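(* Let $V_1,V_2\in C^\infty(\mathbb{R},\mathbb{R})$, $m\in\mathbb{R}$, and $K_i(z_i,w_i)=\frac{w_i^2}{2}+V_i(z_i^2)$ for $i=1,2$. Let $J\subset\mathbb{R}$ be an open interval such that for every $a\in J$, with $b=m-a$, the level sets $\{K_1=a\}$ and $\{K_2=b\}$ are regular closed simple curves in $\mathbb{R}^2$. Let $I_1(a)$ and $I_2(b)$ be the corresponding action variables, and regard $I_2$ as a function of $I_1$ through the relation $a+b=m$. Then: (i) $I_2$ is a convex function of $I_1$ if $I_1''(a)>0$ and $I_2''(b)>0$ (for all $a\in J$ and $b\in m-J$); (ii) $I_2$ is a concave function of $I_1$ if $I_1''(a)<0$ and $I_2''(b)<0$ (for all $a\in J$ and $b\in m-J$).
   Context: The action variables are $I_1(a)=\frac{1}{2\pi}\int_{\{K_1=a\}}w_1\,dz_1$ and $I_2(b)=\frac{1}{2\pi}\int_{\{K_2=b\}}w_2\,dz_2$, i.e. $\frac{1}{2\pi}$ times the areas enclosed by the closed curves $\{K_1=a\}$ and $\{K_2=b\}$; they are strictly increasing in $a\in J$ and $b\in m-J$ respectively. That $I_2$ is regarded as a function of $I_1$ means: the function $\varphi:I_1(J)\to\mathbb{R}$ with $\varphi(I_1(a))=I_2(m-a)$ for all $a\in J$. *)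

theory Defs
  imports "HOL-Analysis.Analysis"
begin

definition smooth :: "(real \<Rightarrow> real) \<Rightarrow> bool"
  where "smooth f \<longleftrightarrow> (\<forall>n. (deriv ^^ n) f differentiable_on UNIV)"

definition hamiltonian :: "(real \<Rightarrow> real) \<Rightarrow> real \<times> real \<Rightarrow> real"
  where "hamiltonian V = (\<lambda>(z, w). w\<^sup>2 / 2 + V (z\<^sup>2))"

definition level_set :: "(real \<times> real \<Rightarrow> real) \<Rightarrow> real \<Rightarrow> (real \<times> real) set"
  where "level_set K e = {p. K p = e}"

(* Periodicity on the whole line makes the curve regular at the closing point as well. *)
definition parametrizes :: "(real \<Rightarrow> real \<times> real) \<Rightarrow> (real \<times> real) set \<Rightarrow> bool"
  where "parametrizes \<gamma> C \<longleftrightarrow>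
    \<gamma> C1_differentiable_on UNIV \<and> (\<forall>t. vector_derivative \<gamma> (at t) \<noteq> 0) \<and>
    (\<forall>t. \<gamma> (t + 1) = \<gamma> t) \<and> inj_on \<gamma> {0..<1} \<and> range \<gamma> = C"

definition regular_simple_closed_curve :: "(real \<times> real) set \<Rightarrow> bool"
  where "regular_simple_closed_curve C \<longleftrightarrow> (\<exists>\<gamma>. parametrizes \<gamma> C)"

definition integral_w_dz :: "(real \<Rightarrow> real \<times> real) \<Rightarrow> real"
  where "integral_w_dz \<gamma> =
    integral {0..1} (\<lambda>t. snd (\<gamma> t) * fst (vector_derivative \<gamma> (at t)))"

(* Two parametrizations of the same curve differ by a reparametrization, so the line integral
   depends on the choice only through its sign. The absolute value selects the orientation for
   which it is the enclosed area. *)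
definition action :: "(real \<times> real \<Rightarrow> real) \<Rightarrow> real \<Rightarrow> real"
  where "action K e = 1 / (2 * pi) * \<bar>integral_w_dz (SOME \<gamma>. parametrizes \<gamma> (level_set K e))\<bar>"

end

theory Submission
  imports Defs
begin

text \<open>
  Write \<open>U x = V (x\<^sup>2)\<close>. The argument has an analytic half, that the actions are increasing
  and genuinely twice differentiable, and a short convexity half.

  Convexity. The function \<open>\<phi>\<close> sends \<open>x\<close> to \<open>I2 (m - a)\<close>, where \<open>a\<close> is the inverse of the increasing
  function \<open>I1\<close> at \<open>x\<close>. If \<open>I1\<close> is convex, its inverse is concave, so \<open>m - a\<close> is a convex function of
  \<open>x\<close>, and an increasing convex \<open>I2\<close> preserves this (\<open>convex_on_composed_inverse\<close>). The concave case is the same statement seen through the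
  point reflection \<open>x \<mapsto> - x\<close>, \<open>y \<mapsto> - y\<close>.

  Shape of a level curve. If \<open>{w\<^sup>2 / 2 + U z = a}\<close> is a regular simple closed curve, its
  projection \<open>{U \<le> a}\<close> is a compact interval \<open>[-r, r]\<close>. Inside it \<open>U < a\<close>, because an inner point
  with \<open>U = a\<close> would disconnect the circle, and \<open>U' r > 0\<close>, because \<open>U' r = 0\<close> would force the
  velocity of the curve to vanish at \<open>(r, 0)\<close> (\<open>ex_well_level\<close>). The points \<open>(- r, 0)\<close> and
  \<open>(r, 0)\<close> cut the curve into an upper and a lower graph, each of which contributes the same integral;
  hence the action equals \<open>(2 / \<pi>) \<integral>\<^sub>0\<^sup>r \<surd>(2 (a - U x)) dx\<close> (\<open>curve_integral\<close>), whatever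
  parametrization is chosen.

  Differentiability. The operator \<open>deriv\<close> has some value even where there is no derivative, so
  a sign of \<open>deriv (deriv I)\<close> is informative only once \<open>I\<close> is known to be twice differentiable. The
  integrand has a square root singularity at the moving endpoint \<open>r a\<close>, which rules out direct
  differentiation under the integral sign. For a lower energy \<open>c\<close> in \<open>J\<close> the integral is split at
  \<open>r c\<close>. On \<open>[0, r c]\<close> the integrand is smooth in \<open>a\<close>. On \<open>[r c, r a]\<close> the function \<open>r\<close> inverts
  \<open>U\<close>, and the substitution \<open>x = r (a - (a - c) t\<^sup>2)\<close> turns the integral into one over \<open>[0, 1]\<close> with
  a smooth integrand (\<open>outer_integral\<close>). Both pieces are then differentiated twice by Leibniz's rule.
\<close>

section \<open>Level curves of an even potential\<close>

text \<open>The shape of \<open>{U \<le> a}\<close> when the energy level \<open>a\<close> is a regular oval: \<open>r\<close> is its turning point.\<close>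

definition well_level :: "(real \<Rightarrow> real) \<Rightarrow> real \<Rightarrow> real \<Rightarrow> bool"
  where "well_level U a r \<longleftrightarrow> 0 < r \<and> U r = a \<and> 0 < deriv U r \<and>
    (\<forall>x. \<bar>x\<bar> < r \<longrightarrow> U x < a) \<and> (\<forall>x. r < \<bar>x\<bar> \<longrightarrow> a < U x)"

text \<open>A quarter of the area enclosed by the level curve.\<close>

definition well_integral :: "(real \<Rightarrow> real) \<Rightarrow> real \<Rightarrow> real \<Rightarrow> real"
  where "well_integral U a r = integral {0..r} (\<lambda>x. sqrt (2 * (a - U x)))"

text \<open>
  The components \<open>z\<close> and \<open>w\<close> of a parametrized level curve, with velocity \<open>(z1, w1)\<close>. The
  second derivative of \<open>U\<close> shows that a turning point that is critical for \<open>U\<close> would be a cusp.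
\<close>

locale level_curve =
  fixes U U1 U2 :: "real \<Rightarrow> real" and a :: real
    and z w z1 w1 :: "real \<Rightarrow> real"
  assumes U_deriv: "(U has_real_derivative U1 x) (at x)"
    and U1_deriv: "(U1 has_real_derivative U2 x) (at x)"
    and U_even: "U (- x) = U x"
    and z_deriv: "(z has_real_derivative z1 t) (at t)"
    and w_deriv: "(w has_real_derivative w1 t) (at t)"
    and cont_z1: "continuous_on UNIV z1"
    and cont_w1: "continuous_on UNIV w1"
    and regular: "z1 t \<noteq> 0 \<or> w1 t \<noteq> 0"
    and periodic: "z (t + 1) = z t" "w (t + 1) = w t"
    and injective: "\<lbrakk>0 \<le> s; s < 1; 0 \<le> t; t < 1; z s = z t; w s = w t\<rbrakk> \<Longrightarrow> s = t"
    and energy: "(w t)\<^sup>2 / 2 + U (z t) = a"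
    and onto: "y\<^sup>2 / 2 + U x = a \<Longrightarrow> \<exists>t. z t = x \<and> w t = y"
begin

lemma cont_U: "continuous_on S U"
  using U_deriv DERIV_continuous_on has_field_derivative_at_within by blast

lemma cont_z: "continuous_on S z"
  using z_deriv DERIV_continuous_on has_field_derivative_at_within by blast

lemma cont_w: "continuous_on S w"
  using w_deriv DERIV_continuous_on has_field_derivative_at_within by blast

lemma periodic_nat: "z (t + real n) = z t \<and> w (t + real n) = w t"
proof (induction n)
  case (Suc n)
  then show ?case using periodic[of "t + real n"] by (simp add: algebra_simps)
qed simp

lemma periodic_int: "z (t + of_int n) = z t \<and> w (t + of_int n) = w t"
proof (cases "n \<ge> 0")
  case True
  then show ?thesis using periodic_nat[of t "nat n"] by simp
next
  case False
  then show ?thesis using periodic_nat[of "t + of_int n" "nat (- n)"] by simp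
qed

lemma periodic_frac: "z (frac t) = z t \<and> w (frac t) = w t"
  using periodic_int[of t "- \<lfloor>t\<rfloor>"] by (simp add: frac_def)

text \<open>
  The parameter may start at any \<open>t0\<close>; the curve will be cut at its leftmost point, not at parameter 0.
\<close>

lemma injective_period:
  assumes "t0 \<le> s" "s < t0 + 1" "t0 \<le> t" "t < t0 + 1" "z s = z t" "w s = w t"
  shows "s = t"
proof -
  have "frac s = frac t"
    by (rule injective) (use assms periodic_frac frac_ge_0 frac_lt_1 in auto)
  then have "s - t = of_int (\<lfloor>s\<rfloor> - \<lfloor>t\<rfloor>)" by (simp add: frac_def)
  moreover have "\<bar>s - t\<bar> < 1" using assms by linarith
  ultimately have "\<bar>of_int (\<lfloor>s\<rfloor> - \<lfloor>t\<rfloor>) :: real\<bar> < 1" by simp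
  then have "\<lfloor>s\<rfloor> - \<lfloor>t\<rfloor> = 0" by linarith
  then show ?thesis using \<open>s - t = _\<close> by simp
qed

lemma hit_in_period:
  assumes "y\<^sup>2 / 2 + U x = a"
  obtains t where "t0 \<le> t" "t < t0 + 1" "z t = x" "w t = y"
proof -
  obtain u where u: "z u = x" "w u = y" using onto[OF assms] by blast
  have "z (t0 + frac (u - t0)) = x \<and> w (t0 + frac (u - t0)) = y"
    using periodic_int[of u "- \<lfloor>u - t0\<rfloor>"] u by (simp add: frac_def algebra_simps)
  moreover have "t0 \<le> t0 + frac (u - t0)" "t0 + frac (u - t0) < t0 + 1"
    using frac_ge_0 frac_lt_1 by auto
  ultimately show thesis using that by blast
qed

lemma U_z_le: "U (z t) \<le> a"
  using energy[of t] zero_le_power2[of "w t"] by linarith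

lemma range_z: "z ` {0..1} = {x. U x \<le> a}"
proof (intro equalityI subsetI)
  fix x assume "x \<in> {x. U x \<le> a}"
  then have "(sqrt (2 * (a - U x)))\<^sup>2 / 2 + U x = a" by (simp add: field_simps)
  from hit_in_period[OF this, of 0] show "x \<in> z ` {0..1}" by (metis add_0 atLeastAtMost_iff image_eqI less_imp_le)
qed (use U_z_le in auto)

text \<open>
  At the rightmost point \<open>z1 = 0\<close>. The energy identity differentiates to \<open>w w1 + U' (z) z1 = 0\<close>; if
  \<open>U' r = 0\<close>, both \<open>w\<close> and \<open>U' (z)\<close> vanish there, and dividing by the parameter increment gives
  \<open>w1\<^sup>2 + (U' (z))' z1 = 0\<close> in the limit, hence \<open>w1 = 0\<close> as well, against regularity. As \<open>w1\<close> is
  only continuous, difference quotients replace a second differentiation.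
\<close>

lemma derivative_nonzero_at_turning_point:
  assumes "U r = a" and max: "\<And>x. U x \<le> a \<Longrightarrow> x \<le> r"
  shows "U1 r \<noteq> 0"
proof
  assume "U1 r = 0"
  obtain t where t: "z t = r" "w t = 0"
    using onto[of 0 r] assms(1) by auto
  have "z1 t = 0"
    by (rule DERIV_local_max[OF z_deriv zero_less_one]) (use t max U_z_le in auto)
  have eq: "w s * w1 s + U1 (z s) * z1 s = 0" for s
  proof -
    have "((\<lambda>s. (w s)\<^sup>2 / 2 + U (z s)) has_real_derivative w s * w1 s + U1 (z s) * z1 s) (at s)"
      by (auto intro!: derivative_eq_intros w_deriv DERIV_chain2[OF U_deriv z_deriv])
    moreover have "((\<lambda>s. (w s)\<^sup>2 / 2 + U (z s)) has_real_derivative 0) (at s)"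
      unfolding energy by simp
    ultimately show ?thesis by (rule DERIV_unique)
  qed
  have lim_w: "((\<lambda>h. (w (t + h) - w t) / h) \<longlongrightarrow> w1 t) (at 0)"
    using w_deriv[of t] by (simp add: DERIV_def)
  have "((\<lambda>s. U1 (z s)) has_real_derivative U2 (z t) * z1 t) (at t)"
    by (rule DERIV_chain2[OF U1_deriv z_deriv])
  then have lim_U: "((\<lambda>h. (U1 (z (t + h)) - U1 (z t)) / h) \<longlongrightarrow> U2 (z t) * z1 t) (at 0)"
    by (simp add: DERIV_def)
  have "isCont w1 t" "isCont z1 t"
    using cont_w1 cont_z1 by (simp_all add: continuous_on_eq_continuous_at)
  then have lim1: "((\<lambda>h. w1 (t + h)) \<longlongrightarrow> w1 t) (at 0)" "((\<lambda>h. z1 (t + h)) \<longlongrightarrow> z1 t) (at 0)"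
    by (simp_all add: isCont_iff)
  have "((\<lambda>h. (w (t + h) - w t) / h * w1 (t + h) + (U1 (z (t + h)) - U1 (z t)) / h * z1 (t + h))
      \<longlongrightarrow> w1 t * w1 t + U2 (z t) * z1 t * z1 t) (at 0)"
    by (intro tendsto_intros lim_w lim_U lim1)
  moreover have "(w (t + h) - w t) / h * w1 (t + h) + (U1 (z (t + h)) - U1 (z t)) / h * z1 (t + h) = 0" for h
    using eq[of "t + h"] t \<open>U1 r = 0\<close> by (simp add: add_divide_distrib[symmetric])
  ultimately have "w1 t * w1 t + U2 (z t) * z1 t * z1 t = 0"
    using LIM_const_eq by fastforce
  then show False using \<open>z1 t = 0\<close> regular[of t] by simp
qed

text \<open>
  An inner point with \<open>U x = a\<close> is the only point of the curve above \<open>x\<close>. The curve without it is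
  still connected, but would reach from \<open>- r\<close> to \<open>r\<close> without passing over \<open>x\<close>.
\<close>

lemma below_inside:
  assumes "U r = a" and "\<bar>x\<bar> < r" and "U x \<le> a"
  shows "U x < a"
proof (rule ccontr)
  assume "\<not> U x < a"
  then have x: "U x = a" using assms by simp
  obtain t0 where t0: "z t0 = x" "w t0 = 0" using onto[of 0 x] x by auto
  obtain t1 where t1: "t0 \<le> t1" "t1 < t0 + 1" "z t1 = r" "w t1 = 0"
    using hit_in_period[of 0 r t0] assms(1) by auto
  obtain t2 where t2: "t0 \<le> t2" "t2 < t0 + 1" "z t2 = - r" "w t2 = 0"
    using hit_in_period[of 0 "- r" t0] assms(1) U_even by auto
  have "t0 \<noteq> t1" "t0 \<noteq> t2" using t0 t1 t2 assms(2) by auto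
  then have "t0 < t1" "t0 < t2" using t1 t2 by auto
  have "connected (z ` {t0<..<t0 + 1})"
    by (intro connected_continuous_image cont_z) simp
  moreover have "- r \<in> z ` {t0<..<t0 + 1}" "r \<in> z ` {t0<..<t0 + 1}"
    using t1 t2 \<open>t0 < t1\<close> \<open>t0 < t2\<close> by force+
  ultimately have "x \<in> z ` {t0<..<t0 + 1}"
    by (rule connectedD_interval) (use assms(2) in auto)
  then obtain s where s: "t0 < s" "s < t0 + 1" "z s = x" by auto
  have "w s = 0" using energy[of s] s x by simp
  then have "t0 = s" using injective_period[of t0 t0 s] s t0 by auto
  then show False using s by simp
qed

lemma ex_well_level: "\<exists>r. well_level U a r"
proof -
  let ?P = "{x. U x \<le> a}"
  have "compact ?P" "connected ?P" "?P \<noteq> {}"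
    unfolding range_z[symmetric]
    by (auto intro!: compact_continuous_image connected_continuous_image cont_z)
  obtain r where r: "U r \<le> a" "\<And>x. U x \<le> a \<Longrightarrow> x \<le> r"
    using compact_attains_sup[OF \<open>compact ?P\<close> \<open>?P \<noteq> {}\<close>] by auto
  have inside: "U x \<le> a" if "\<bar>x\<bar> \<le> r" for x
  proof -
    have "x \<in> ?P"
      by (rule connectedD_interval[OF \<open>connected ?P\<close>, of "- r" r]) (use r U_even that in auto)
    then show ?thesis by simp
  qed
  have outside: "a < U x" if "r < \<bar>x\<bar>" for x
    using r(2)[of x] r(2)[of "- x"] U_even[of x] that by fastforce
  have "a \<le> U r"
  proof (rule tendsto_lowerbound)
    show "(U \<longlongrightarrow> U r) (at_right r)"
      using DERIV_isCont[OF U_deriv] by (simp add: isCont_def filterlim_at_split)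
    show "\<forall>\<^sub>F x in at_right r. a \<le> U x"
      by (rule eventually_at_rightI[of r "r + 1"]) (auto intro!: less_imp_le outside)
  qed simp
  then have Ur: "U r = a" using r by simp
  have "0 \<le> r" using r(2)[of "- r"] r(1) U_even[of r] by simp
  have "r \<noteq> 0"
  proof
    assume "r = 0"
    then have z0: "z t = 0" for t
      using outside[of "z t"] U_z_le[of t] by fastforce
    then have "w t = 0" for t
      using energy[of t] Ur \<open>r = 0\<close> by simp
    then show False using injective[of 0 "1/2"] z0 by simp
  qed
  then have "0 < r" using \<open>0 \<le> r\<close> by simp
  \<comment> \<open>It is not zero by regularity, and not negative since \<open>U\<close> does not exceed \<open>a\<close> on the left of \<open>r\<close>.\<close>
  have "0 < U1 r"
  proof -
    have "U1 r \<noteq> 0" by (rule derivative_nonzero_at_turning_point[OF Ur r(2)])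
    moreover have "\<not> U1 r < 0"
    proof
      assume "U1 r < 0"
      then obtain d where d: "d > 0" "\<And>h. 0 < h \<Longrightarrow> h < d \<Longrightarrow> U (r - h) > U r"
        using DERIV_neg_dec_left[OF U_deriv] by blast
      have "U (r - min d r / 2) > U r"
        by (rule d(2)) (use d(1) \<open>0 < r\<close> in auto)
      moreover have "U (r - min d r / 2) \<le> a"
        by (rule inside) (use d(1) \<open>0 < r\<close> in auto)
      ultimately show False using Ur by simp
    qed
    ultimately show ?thesis by simp
  qed
  moreover have "deriv U r = U1 r" by (rule DERIV_imp_deriv[OF U_deriv])
  ultimately show ?thesis
    unfolding well_level_def
    using \<open>0 < r\<close> Ur below_inside[OF Ur _ inside] outside by (intro exI[of _ r]) auto
qed

text \<open>
  On an arc where \<open>w\<close> keeps its sign \<open>\<sigma>\<close>, \<open>w = \<sigma> \<surd>(2 (a - U z))\<close>, so the line integral depends only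
  on the endpoints. An integral over an empty interval is 0; the difference on the right is therefore the
  oriented integral from \<open>z s\<close> to \<open>z t\<close>.
\<close>

lemma arc_integral:
  assumes r: "well_level U a r" and "s \<le> t" and "\<bar>\<sigma>\<bar> = 1"
    and sign: "\<And>u. s < u \<Longrightarrow> u < t \<Longrightarrow> 0 < \<sigma> * w u"
  defines "f \<equiv> \<lambda>x. sqrt (2 * (a - U x))"
  shows "integral {s..t} (\<lambda>u. w u * z1 u) =
    \<sigma> * (integral {z s..z t} f - integral {z t..z s} f)"
proof -
  have zr: "z u \<in> {-r..r}" for u
    using r U_z_le[of u] unfolding well_level_def by (fastforce simp: not_less[symmetric])
  have "((\<lambda>u. z1 u *\<^sub>R f (z u)) has_integral
      integral {z s..z t} f - integral {z t..z s} f) {s..t}"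
    unfolding f_def
    by (rule has_integral_substitution_general[where s = "{}" and c = "-r" and d = r])
      (use zr \<open>s \<le> t\<close> in \<open>auto intro!: continuous_intros cont_U cont_z
        has_field_derivative_at_within[OF z_deriv]\<close>)
  then have "((\<lambda>u. \<sigma> * (z1 u *\<^sub>R f (z u))) has_integral
      \<sigma> * (integral {z s..z t} f - integral {z t..z s} f)) {s..t}"
    by (rule has_integral_mult_right)
  then have "((\<lambda>u. w u * z1 u) has_integral
      \<sigma> * (integral {z s..z t} f - integral {z t..z s} f)) {s..t}"
  proof (rule has_integral_spike_finite[of "{s, t}", rotated 2])
    fix u assume "u \<in> {s..t} - {s, t}"
    then have "0 < \<sigma> * w u" using sign by auto
    moreover have "f (z u) = \<bar>w u\<bar>"
      using energy[of u] unfolding f_def by (simp add: real_sqrt_abs[symmetric] del: real_sqrt_abs)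
    ultimately have "w u = \<sigma> * f (z u)"
      using \<open>\<bar>\<sigma>\<bar> = 1\<close> by (auto simp: abs_if zero_less_mult_iff split: if_splits)
    then show "w u * z1 u = \<sigma> * (z1 u *\<^sub>R f (z u))" by simp
  qed simp
  then show ?thesis by (rule integral_unique)
qed

lemma integral_period: "integral {t0..t0 + 1} (\<lambda>t. w t * z1 t) = integral {0..1} (\<lambda>t. w t * z1 t)"
proof -
  let ?F = "\<lambda>t. w t * z1 t"
  have cont: "continuous_on S ?F" for S
    by (intro continuous_intros cont_w continuous_on_subset[OF cont_z1]) simp
  have int: "?F integrable_on {x..y}" for x y
    by (rule integrable_continuous_real[OF cont])
  have shift: "integral {x + of_int n..y + of_int n} ?F = integral {x..y} ?F" for x y n
  proof -
    have "z1 (t + of_int n) = z1 t" for t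
    proof (rule DERIV_unique)
      show "(z has_real_derivative z1 t) (at t)" by (rule z_deriv)
      show "(z has_real_derivative z1 (t + of_int n)) (at t)"
        using z_deriv[of "t + of_int n"] by (simp add: DERIV_shift periodic_int)
    qed
    then show ?thesis
      using integral_shift_real_ivl[of "x + of_int n" "of_int n" "y + of_int n" ?F]
      by (simp add: periodic_int)
  qed
  have one: "integral {1..1 + x} ?F = integral {0..x} ?F" for x
    using shift[of 0 1 x] by (simp add: add.commute)
  have f: "0 \<le> frac t0" "frac t0 \<le> 1" using frac_lt_1[of t0] by auto
  have "integral {t0..t0 + 1} ?F = integral {frac t0..1 + frac t0} ?F"
    using shift[of "frac t0" "\<lfloor>t0\<rfloor>" "1 + frac t0"] by (simp add: frac_def algebra_simps)
  also have "\<dots> = integral {frac t0..1} ?F + integral {1..1 + frac t0} ?F"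
    using f by (intro Henstock_Kurzweil_Integration.integral_combine[symmetric] int) auto
  also have "\<dots> = integral {0..frac t0} ?F + integral {frac t0..1} ?F"
    by (simp add: one)
  also have "\<dots> = integral {0..1} ?F"
    using f by (intro Henstock_Kurzweil_Integration.integral_combine int) auto
  finally show ?thesis .
qed

lemma sign_on_arc:
  assumes "s < t" and nz: "\<And>u. s < u \<Longrightarrow> u < t \<Longrightarrow> w u \<noteq> 0"
  obtains \<sigma> where "\<bar>\<sigma>\<bar> = 1" "\<And>u. s < u \<Longrightarrow> u < t \<Longrightarrow> 0 < \<sigma> * w u"
proof -
  have conn: "connected (w ` {s<..<t})"
    by (intro connected_continuous_image cont_w) simp
  have "(\<forall>u\<in>{s<..<t}. 0 < w u) \<or> (\<forall>u\<in>{s<..<t}. w u < 0)"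
  proof (rule ccontr)
    assume "\<not> ?thesis"
    then obtain u v where "u \<in> {s<..<t}" "w u \<le> 0" "v \<in> {s<..<t}" "0 \<le> w v" by force
    then have "0 \<in> w ` {s<..<t}"
      using connectedD_interval[OF conn, of "w u" "w v" 0] by auto
    then show False using nz by force
  qed
  then show thesis
  proof
    assume "\<forall>u\<in>{s<..<t}. 0 < w u" then show thesis by (intro that[of 1]) auto
  next
    assume "\<forall>u\<in>{s<..<t}. w u < 0" then show thesis by (intro that[of "-1"]) auto
  qed
qed

text \<open>
  Between the two turning points \<open>w\<close> has no zero, so each arc lies in one half plane. Since the curve
  has a point above and a point below \<open>z = 0\<close>, the two arcs lie in opposite half planes; they are
  traversed in opposite directions as well, so their contributions add up.
\<close>

lemma curve_integral:
  assumes r: "well_level U a r"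
  shows "\<bar>integral {0..1} (\<lambda>t. w t * z1 t)\<bar> = 4 * well_integral U a r"
proof -
  let ?F = "\<lambda>t. w t * z1 t" and ?f = "\<lambda>x. sqrt (2 * (a - U x))"
  let ?I = "integral {-r..r} ?f"
  have rpos: "0 < r" and Ur: "U r = a" and Uin: "\<And>x. \<bar>x\<bar> < r \<Longrightarrow> U x < a"
    and Uout: "\<And>x. r < \<bar>x\<bar> \<Longrightarrow> a < U x"
    using r by (auto simp: well_level_def)
  obtain t0 where t0: "z t0 = - r" "w t0 = 0" using onto[of 0 "- r"] Ur U_even by auto
  obtain t1 where t1: "t0 \<le> t1" "t1 < t0 + 1" "z t1 = r" "w t1 = 0"
    using hit_in_period[of 0 r t0] Ur by auto
  have "t0 < t1" using t0 t1 rpos by (cases "t0 = t1") auto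
  have zeros: "u = t0 \<or> u = t1" if "t0 \<le> u" "u < t0 + 1" "w u = 0" for u
  proof -
    have "U (z u) = a" using energy[of u] that by simp
    then have "\<bar>z u\<bar> = r" using Uin[of "z u"] Uout[of "z u"] by linarith
    then have "z u = r \<or> z u = - r" by linarith
    then show ?thesis
      using injective_period[of t0 u t0] injective_period[of t0 u t1] that t0 t1 by auto
  qed
  obtain \<sigma> where \<sigma>: "\<bar>\<sigma>\<bar> = 1" "\<And>u. t0 < u \<Longrightarrow> u < t1 \<Longrightarrow> 0 < \<sigma> * w u"
    using sign_on_arc[OF \<open>t0 < t1\<close>] zeros t1 by (metis less_imp_le less_irrefl less_trans)
  obtain \<tau> where \<tau>: "\<bar>\<tau>\<bar> = 1" "\<And>u. t1 < u \<Longrightarrow> u < t0 + 1 \<Longrightarrow> 0 < \<tau> * w u"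
    using sign_on_arc[OF \<open>t1 < t0 + 1\<close>] zeros t1
    by (metis less_imp_le less_irrefl less_le_trans order_trans)
  have "\<tau> = - \<sigma>"
  proof (rule ccontr)
    assume "\<tau> \<noteq> - \<sigma>"
    then have "\<tau> = \<sigma>" using \<sigma>(1) \<tau>(1) by (auto simp: abs_if split: if_splits)
    \<comment> \<open>The point of the curve over \<open>0\<close> on the side that both arcs would miss.\<close>
    let ?y = "- \<sigma> * sqrt (2 * (a - U 0))"
    have "\<sigma>\<^sup>2 = 1" using \<sigma>(1) by (metis power2_abs power_one)
    then have "?y\<^sup>2 / 2 + U 0 = a"
      using Uin[of 0] rpos by (simp add: power_mult_distrib field_simps)
    then obtain u where u: "t0 \<le> u" "u < t0 + 1" "w u = ?y"
      by (rule hit_in_period)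
    have neg: "\<sigma> * w u < 0"
      using u \<open>\<sigma>\<^sup>2 = 1\<close> Uin[of 0] rpos by (simp add: power2_eq_square flip: mult.assoc)
    then have "u \<noteq> t0" "u \<noteq> t1" using t0 t1 by auto
    then show False using neg \<sigma>(2)[of u] \<tau>(2)[of u] \<open>\<tau> = \<sigma>\<close> u by force
  qed
  have cont: "continuous_on S ?F" for S
    by (intro continuous_intros cont_w continuous_on_subset[OF cont_z1]) simp
  have empty: "integral {r..-r} ?f = 0" using rpos by simp
  have "integral {0..1} ?F = integral {t0..t0 + 1} ?F" by (rule integral_period[symmetric])
  also have "\<dots> = integral {t0..t1} ?F + integral {t1..t0 + 1} ?F"
    using t1 by (intro Henstock_Kurzweil_Integration.integral_combine[symmetric]
        integrable_continuous_real[OF cont]) auto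
  also have "integral {t0..t1} ?F = \<sigma> * ?I"
    using arc_integral[OF r \<open>t0 \<le> t1\<close> \<sigma>] t0 t1 empty by simp
  also have "integral {t1..t0 + 1} ?F = \<sigma> * ?I"
    using arc_integral[OF r _ \<tau>] t0 t1 empty periodic[of t0] \<open>\<tau> = - \<sigma>\<close> by simp
  finally have "integral {0..1} ?F = 2 * \<sigma> * ?I" by simp
  moreover have "?I = 2 * well_integral U a r"
  proof -
    have "?I = integral {-r..0} ?f + integral {0..r} ?f"
      using rpos by (intro Henstock_Kurzweil_Integration.integral_combine[symmetric]
          integrable_continuous_real continuous_intros cont_U) auto
    moreover have "integral {-r..0} ?f = integral {0..r} ?f"
      using Henstock_Kurzweil_Integration.integral_reflect_real[where a = 0 and b = r and f = ?f]
      by (simp add: U_even)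
    ultimately show ?thesis by (simp add: well_integral_def)
  qed
  moreover have "0 \<le> well_integral U a r"
    unfolding well_integral_def
  proof (rule integral_nonneg)
    show "?f integrable_on {0..r}"
      by (intro integrable_continuous_real continuous_intros cont_U)
    show "\<And>x. x \<in> {0..r} \<Longrightarrow> 0 \<le> ?f x"
      using Uin Ur by (smt (verit, best) atLeastAtMost_iff real_sqrt_ge_zero)
  qed
  ultimately show ?thesis using \<sigma>(1) by (simp add: abs_mult)
qed

end

section \<open>Twice differentiable functions\<close>

definition twice_differentiable :: "(real \<Rightarrow> real) \<Rightarrow> real set \<Rightarrow> bool"
  where "twice_differentiable f S \<longleftrightarrow> (\<exists>f1 f2. \<forall>x\<in>S.
    (f has_real_derivative f1 x) (at x) \<and> (f1 has_real_derivative f2 x) (at x))"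

lemma twice_differentiable_add:
  assumes "twice_differentiable f S" "twice_differentiable g S"
  shows "twice_differentiable (\<lambda>x. f x + g x) S"
proof -
  obtain f1 f2 g1 g2 where
    "\<And>x. x \<in> S \<Longrightarrow> (f has_real_derivative f1 x) (at x)"
    "\<And>x. x \<in> S \<Longrightarrow> (f1 has_real_derivative f2 x) (at x)"
    "\<And>x. x \<in> S \<Longrightarrow> (g has_real_derivative g1 x) (at x)"
    "\<And>x. x \<in> S \<Longrightarrow> (g1 has_real_derivative g2 x) (at x)"
    using assms unfolding twice_differentiable_def by metis
  then show ?thesis unfolding twice_differentiable_def
    by (intro exI[of _ "\<lambda>x. f1 x + g1 x"] exI[of _ "\<lambda>x. f2 x + g2 x"])
      (auto intro!: derivative_intros)
qed

lemma twice_differentiable_mult: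
  assumes "twice_differentiable f S" "twice_differentiable g S"
  shows "twice_differentiable (\<lambda>x. f x * g x) S"
proof -
  obtain f1 f2 g1 g2 where
    "\<And>x. x \<in> S \<Longrightarrow> (f has_real_derivative f1 x) (at x)"
    "\<And>x. x \<in> S \<Longrightarrow> (f1 has_real_derivative f2 x) (at x)"
    "\<And>x. x \<in> S \<Longrightarrow> (g has_real_derivative g1 x) (at x)"
    "\<And>x. x \<in> S \<Longrightarrow> (g1 has_real_derivative g2 x) (at x)"
    using assms unfolding twice_differentiable_def by metis
  then show ?thesis unfolding twice_differentiable_def
    by (intro exI[of _ "\<lambda>x. f1 x * g x + f x * g1 x"]
        exI[of _ "\<lambda>x. (f2 x * g x + f1 x * g1 x) + (f1 x * g1 x + f x * g2 x)"])
      (auto intro!: derivative_eq_intros)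
qed

lemma twice_differentiable_const: "twice_differentiable (\<lambda>x. c) S"
  unfolding twice_differentiable_def
  by (intro exI[of _ "\<lambda>x. 0"]) auto

text \<open>
  The function \<open>g\<close> need agree with \<open>f\<close> only on \<open>S\<close>: the closed formula for the action depends on an
  auxiliary energy and is valid only above it.
\<close>

lemma twice_differentiable_imp_deriv:
  assumes "twice_differentiable f S" "open S" "\<And>x. x \<in> S \<Longrightarrow> g x = f x" "x \<in> S"
  shows "(g has_real_derivative deriv g x) (at x)"
    and "(deriv g has_real_derivative deriv (deriv g) x) (at x)"
proof -
  obtain f1 f2 where
    f: "\<And>x. x \<in> S \<Longrightarrow> (f has_real_derivative f1 x) (at x)"
    "\<And>x. x \<in> S \<Longrightarrow> (f1 has_real_derivative f2 x) (at x)"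
    using assms(1) unfolding twice_differentiable_def by metis
  have g: "(g has_real_derivative f1 y) (at y)" if "y \<in> S" for y
    by (rule has_field_derivative_transform_within_open[OF f(1)[OF that] assms(2) that])
      (simp add: assms(3))
  then have g1: "deriv g y = f1 y" if "y \<in> S" for y
    using that DERIV_imp_deriv by blast
  have "(deriv g has_real_derivative f2 x) (at x)"
    by (rule has_field_derivative_transform_within_open[OF f(2)[OF assms(4)] assms(2,4)])
      (simp add: g1)
  then show "(deriv g has_real_derivative deriv (deriv g) x) (at x)"
    using DERIV_imp_deriv by metis
  show "(g has_real_derivative deriv g x) (at x)" using g g1 assms(4) by simp
qed

lemma twice_differentiable_integral:
  fixes g :: "real \<Rightarrow> real \<Rightarrow> real"
  assumes S: "open S" "convex S"
    and g: "\<And>x t. x \<in> S \<Longrightarrow> t \<in> {p..q} \<Longrightarrow> ((\<lambda>x. g x t) has_real_derivative g' x t) (at x)"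
    and g1: "\<And>x t. x \<in> S \<Longrightarrow> t \<in> {p..q} \<Longrightarrow> ((\<lambda>x. g' x t) has_real_derivative g'' x t) (at x)"
    and cont: "continuous_on (S \<times> {p..q}) (\<lambda>(x, t). g x t)"
    and cont1: "continuous_on (S \<times> {p..q}) (\<lambda>(x, t). g' x t)"
    and cont2: "continuous_on (S \<times> {p..q}) (\<lambda>(x, t). g'' x t)"
  shows "twice_differentiable (\<lambda>x. integral {p..q} (g x)) S"
proof -
  have slice: "f x integrable_on {p..q}"
    if "continuous_on (S \<times> {p..q}) (\<lambda>(x, t). f x t)" "x \<in> S" for f :: "real \<Rightarrow> real \<Rightarrow> real" and x
  proof (rule integrable_continuous_real)
    have "continuous_on {p..q} (\<lambda>t. (\<lambda>(x, t). f x t) (x, t))"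
      by (rule continuous_on_compose2[OF that(1)]) (auto intro!: continuous_intros simp: that(2))
    then show "continuous_on {p..q} (f x)" by simp
  qed
  have step: "((\<lambda>x. integral {p..q} (f x)) has_real_derivative integral {p..q} (f1 x)) (at x)"
    if "x \<in> S" and "continuous_on (S \<times> {p..q}) (\<lambda>(x, t). f x t)"
      "continuous_on (S \<times> {p..q}) (\<lambda>(x, t). f1 x t)"
      "\<And>x t. x \<in> S \<Longrightarrow> t \<in> {p..q} \<Longrightarrow> ((\<lambda>x. f x t) has_real_derivative f1 x t) (at x)"
    for f f1 :: "real \<Rightarrow> real \<Rightarrow> real" and x
  proof -
    have "((\<lambda>x. integral (cbox p q) (f x)) has_real_derivative integral (cbox p q) (f1 x)) (at x within S)"
      by (rule leibniz_rule_field_derivative)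
        (use that S slice in \<open>auto intro: has_field_derivative_at_within\<close>)
    then show ?thesis by (simp add: at_within_open[OF that(1) S(1)])
  qed
  show ?thesis
    unfolding twice_differentiable_def
    by (intro exI[of _ "\<lambda>x. integral {p..q} (g' x)"] exI[of _ "\<lambda>x. integral {p..q} (g'' x)"]
        ballI conjI step cont cont1 cont2 g g1) auto
qed

section \<open>The action as a function of the energy\<close>

locale well_family =
  fixes U U1 U2 U3 :: "real \<Rightarrow> real" and J :: "real set" and r :: "real \<Rightarrow> real"
  assumes U_deriv: "(U has_real_derivative U1 x) (at x)"
    and U1_deriv: "(U1 has_real_derivative U2 x) (at x)"
    and U2_deriv: "(U2 has_real_derivative U3 x) (at x)"
    and cont_U3: "continuous_on UNIV U3"
    and open_J: "open J" and convex_J: "convex J"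
    and well: "a \<in> J \<Longrightarrow> well_level U a (r a)"
begin

lemma cont_U: "continuous_on S U"
  using U_deriv DERIV_continuous_on has_field_derivative_at_within by blast

lemma r_pos: "a \<in> J \<Longrightarrow> 0 < r a"
  and U_r: "a \<in> J \<Longrightarrow> U (r a) = a"
  and U_below: "a \<in> J \<Longrightarrow> \<bar>x\<bar> < r a \<Longrightarrow> U x < a"
  and U_above: "a \<in> J \<Longrightarrow> r a < \<bar>x\<bar> \<Longrightarrow> a < U x"
  using well by (auto simp: well_level_def)

lemma U1_r_pos: "a \<in> J \<Longrightarrow> 0 < U1 (r a)"
  using well[of a] DERIV_imp_deriv[OF U_deriv[of "r a"]] by (simp add: well_level_def)

text \<open>
  As \<open>r\<close> inverts \<open>U\<close> on the whole open set of positive points with energy in \<open>J\<close>, a form of the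
  inverse function theorem applies that yields continuity and differentiability of \<open>r\<close> together.
\<close>

lemma r_unique: "0 < x \<Longrightarrow> U x \<in> J \<Longrightarrow> r (U x) = x"
  using U_below[of "U x" x] U_above[of "U x" x] by (cases x "r (U x)" rule: linorder_cases) auto

lemma r_strict_mono: "a \<in> J \<Longrightarrow> b \<in> J \<Longrightarrow> a < b \<Longrightarrow> r a < r b"
  using U_above[of b "r a"] U_r[of a] U_r[of b] r_pos[of a]
  by (cases "r a" "r b" rule: linorder_cases) auto

lemma r_deriv:
  assumes "a \<in> J"
  shows "(r has_real_derivative inverse (U1 (r a))) (at a)"
  unfolding has_field_derivative_def
proof (rule has_derivative_inverse_strong_x)
  let ?S = "{0<..} \<inter> U -` J"
  show "open ?S"
    by (intro open_Int open_greaterThan open_vimage open_J cont_U)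
  show "r a \<in> ?S" "U (r a) = a" using assms r_pos U_r by auto
  show "continuous_on ?S U" by (rule cont_U)
  show "r (U x) = x" if "x \<in> ?S" for x using that r_unique by simp
  show "(U has_derivative (*) (U1 (r a))) (at (r a))"
    using U_deriv by (simp add: has_field_derivative_def)
  show "(*) (U1 (r a)) \<circ> (*) (inverse (U1 (r a))) = id"
    using U1_r_pos[OF assms] by (auto simp: fun_eq_iff)
qed

text \<open>The first three derivatives of the turning point \<open>r\<close> at energies in \<open>J\<close>.\<close>

definition r1 :: "real \<Rightarrow> real" where "r1 a = inverse (U1 (r a))"
definition r2 :: "real \<Rightarrow> real" where "r2 a = - U2 (r a) * r1 a ^ 3"
definition r3 :: "real \<Rightarrow> real"
  where "r3 a = - (U3 (r a) * r1 a * r1 a ^ 3 + U2 (r a) * (3 * r1 a ^ 2 * r2 a))"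

lemma r1_deriv:
  assumes "a \<in> J"
  shows "(r1 has_real_derivative r2 a) (at a)"
proof -
  have "((\<lambda>a. U1 (r a)) has_real_derivative U2 (r a) * inverse (U1 (r a))) (at a)"
    by (rule DERIV_chain2[OF U1_deriv r_deriv[OF assms]])
  then have "((\<lambda>a. inverse (U1 (r a))) has_real_derivative
      - (inverse (U1 (r a)) * (U2 (r a) * inverse (U1 (r a))) * inverse (U1 (r a)))) (at a)"
    by (rule DERIV_inverse') (use U1_r_pos[OF assms] in simp)
  then show ?thesis
    unfolding r1_def[abs_def] r2_def by (simp add: power3_eq_cube mult_ac)
qed

lemma r2_deriv:
  assumes "a \<in> J"
  shows "(r2 has_real_derivative r3 a) (at a)"
proof -
  have d: "((\<lambda>a. U2 (r a)) has_real_derivative U3 (r a) * r1 a) (at a)"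
    unfolding r1_def by (rule DERIV_chain2[OF U2_deriv r_deriv[OF assms]])
  have "((\<lambda>a. r1 a ^ 3) has_real_derivative 3 * r1 a ^ 2 * r2 a) (at a)"
    using DERIV_power[OF r1_deriv[OF assms], of 3] by (simp add: mult_ac)
  from DERIV_minus[OF DERIV_mult[OF d this]] show ?thesis
    unfolding r2_def[abs_def] r3_def by (simp add: mult_ac)
qed

lemma cont_r: "continuous_on J r"
  by (rule DERIV_continuous_on) (rule has_field_derivative_at_within[OF r_deriv])

lemma cont_r1: "continuous_on J r1"
  by (rule DERIV_continuous_on) (rule has_field_derivative_at_within[OF r1_deriv])

lemma cont_r2: "continuous_on J r2"
  by (rule DERIV_continuous_on) (rule has_field_derivative_at_within[OF r2_deriv])

lemma cont_r3: "continuous_on J r3"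
proof -
  have "continuous_on UNIV U2"
    by (rule DERIV_continuous_on) (rule U2_deriv)
  then have "continuous_on J (\<lambda>a. U2 (r a))" "continuous_on J (\<lambda>a. U3 (r a))"
    using cont_U3 by (auto intro: continuous_on_compose2[OF _ cont_r])
  then show ?thesis
    unfolding r3_def[abs_def] by (intro continuous_intros cont_r1 cont_r2)
qed

lemma between_in_J:
  assumes "a \<in> J" "c \<in> J" "0 \<le> t" "t \<le> 1"
  shows "a - (a - c) * t\<^sup>2 \<in> J"
proof -
  have "t\<^sup>2 \<le> 1" using assms by (simp add: power_le_one)
  then have "(1 - t\<^sup>2) *\<^sub>R a + t\<^sup>2 *\<^sub>R c \<in> J"
    using assms by (intro convexD[OF convex_J]) auto
  then show ?thesis by (simp add: algebra_simps)
qed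

text \<open>
  The substitution \<open>x = r (a - (a - c) t\<^sup>2)\<close> runs from \<open>r a\<close> at \<open>t = 0\<close> to \<open>r c\<close> at \<open>t = 1\<close>. The
  square is chosen so that \<open>\<surd>(2 (a - U x))\<close> becomes \<open>\<surd>(2 (a - c)) t\<close>, which removes the singularity,
  and the limits of integration no longer depend on \<open>a\<close>.
\<close>

lemma outer_integral:
  assumes "a \<in> J" "c \<in> J" "c < a"
  shows "integral {r c..r a} (\<lambda>x. sqrt (2 * (a - U x))) =
    2 * (a - c) * sqrt (2 * (a - c)) * integral {0..1} (\<lambda>t. t\<^sup>2 * r1 (a - (a - c) * t\<^sup>2))"
proof -
  let ?f = "\<lambda>x. sqrt (2 * (a - U x))"
  let ?e = "\<lambda>t. a - (a - c) * t\<^sup>2"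
  let ?\<psi> = "\<lambda>t. r (?e t)"
  have eJ: "?e t \<in> J" if "t \<in> {0..1}" for t
    using between_in_J assms that by simp
  have ce: "c \<le> ?e t" "?e t \<le> a" if "t \<in> {0..1}" for t
  proof -
    have "t\<^sup>2 \<le> 1" using that by (simp add: power_le_one)
    then have "(a - c) * t\<^sup>2 \<le> a - c" using assms(3) by (simp add: mult_left_le)
    then show "c \<le> ?e t" by simp
    show "?e t \<le> a" using assms(3) by simp
  qed
  have \<psi>_deriv: "(?\<psi> has_real_derivative r1 (?e t) * (- (a - c) * (2 * t))) (at t)"
    if "t \<in> {0..1}" for t
  proof -
    have "(?e has_real_derivative - (a - c) * (2 * t)) (at t)"
      by (auto intro!: derivative_eq_intros simp: algebra_simps)
    from DERIV_chain2[OF r_deriv[OF eJ[OF that]] this] show ?thesis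
      unfolding r1_def .
  qed
  have range: "?\<psi> ` {0..1} \<subseteq> {r c..r a}"
  proof (rule image_subsetI)
    fix t :: real assume t: "t \<in> {0..1}"
    have mono: "r u \<le> r v" if "u \<in> J" "v \<in> J" "u \<le> v" for u v
      using r_strict_mono[of u v] that by (cases "u = v") auto
    show "?\<psi> t \<in> {r c..r a}"
      using mono[OF assms(2) eJ[OF t] ce(1)[OF t]] mono[OF eJ[OF t] assms(1) ce(2)[OF t]] by simp
  qed
  have less: "r c < r a" using r_strict_mono assms by blast
  have "((\<lambda>t. (r1 (?e t) * (- (a - c) * (2 * t))) *\<^sub>R ?f (?\<psi> t)) has_integral
      integral {?\<psi> 0..?\<psi> 1} ?f - integral {?\<psi> 1..?\<psi> 0} ?f) {0..1}"
  proof (rule has_integral_substitution_general[where s = "{}", OF _ _ range])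
    show "continuous_on {r c..r a} ?f" by (intro continuous_intros cont_U)
    show "continuous_on {0..1} ?\<psi>"
      by (rule continuous_on_compose2[OF cont_r]) (use eJ in \<open>auto intro!: continuous_intros\<close>)
    show "(?\<psi> has_real_derivative r1 (?e t) * (- (a - c) * (2 * t))) (at t within {0..1})"
      if "t \<in> {0..1} - {}" for t
      using \<psi>_deriv[of t] that by (simp add: has_field_derivative_at_within)
  qed simp_all
  then have sub: "((\<lambda>t. (r1 (?e t) * (- (a - c) * (2 * t))) *\<^sub>R ?f (?\<psi> t)) has_integral
      - integral {r c..r a} ?f) {0..1}"
    using less by simp
  have eq: "(r1 (?e t) * (- (a - c) * (2 * t))) *\<^sub>R ?f (?\<psi> t) =
      - (2 * (a - c) * sqrt (2 * (a - c)) * (t\<^sup>2 * r1 (?e t)))" if "t \<in> {0..1}" for t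
  proof -
    have "?f (?\<psi> t) = sqrt (2 * (a - c) * t\<^sup>2)" using U_r[OF eJ[OF that]] by simp
    also have "\<dots> = sqrt (2 * (a - c)) * t" using that by (simp add: real_sqrt_mult)
    finally have f: "?f (?\<psi> t) = sqrt (2 * (a - c)) * t" .
    have "(H * (- (a - c) * (2 * t))) * (s * t) = - (2 * (a - c) * s * (t\<^sup>2 * H))" for H s
      by (simp add: power2_eq_square algebra_simps)
    then show ?thesis unfolding f real_scaleR_def .
  qed
  have "integral {r c..r a} ?f = - integral {0..1} (\<lambda>t. (r1 (?e t) * (- (a - c) * (2 * t))) *\<^sub>R ?f (?\<psi> t))"
    using integral_unique[OF sub] by simp
  also have "\<dots> = - integral {0..1} (\<lambda>t. - (2 * (a - c) * sqrt (2 * (a - c)) * (t\<^sup>2 * r1 (?e t))))"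
    by (intro arg_cong[where f = uminus] integral_cong eq)
  finally show ?thesis by simp
qed

text \<open>
  For \<open>a > c\<close> the difference \<open>a - U x\<close> stays positive on the fixed interval \<open>[0, r c]\<close>, and
  \<open>a - (a - c) t\<^sup>2\<close> stays in \<open>J\<close>, where \<open>r\<close> has three continuous derivatives.
\<close>

lemma twice_differentiable_well_integral:
  assumes "c \<in> J"
  shows "twice_differentiable (\<lambda>a. integral {0..r c} (\<lambda>x. sqrt (2 * (a - U x))) +
    2 * (a - c) * sqrt (2 * (a - c)) * integral {0..1} (\<lambda>t. t\<^sup>2 * r1 (a - (a - c) * t\<^sup>2)))
    (J \<inter> {c<..})"
proof (intro twice_differentiable_add twice_differentiable_mult)
  let ?S = "J \<inter> {c<..}"
  have S: "open ?S" "convex ?S"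
    using open_J convex_J by (auto intro: open_Int convex_Int convex_real_interval)
  have pos: "0 < a - U x" if "a \<in> ?S" "x \<in> {0..r c}" for a x
    using that U_below[of c x] U_r[of c] assms by (cases "x = r c") auto
  have cU: "continuous_on X (\<lambda>p. U (snd p))" for X :: "(real \<times> real) set"
    by (rule continuous_on_compose2[OF cont_U[of UNIV]]) (auto intro!: continuous_intros)
  show "twice_differentiable (\<lambda>a. integral {0..r c} (\<lambda>x. sqrt (2 * (a - U x)))) ?S"
  proof (rule twice_differentiable_integral[OF S,
        where g' = "\<lambda>a x. inverse (sqrt (2 * (a - U x)))"
        and g'' = "\<lambda>a x. - inverse (sqrt (2 * (a - U x)) ^ 3)"])
    fix a x assume ax: "a \<in> ?S" "x \<in> {0..r c}"
    have p: "0 < 2 * (a - U x)" using pos[OF ax] by simp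
    show d: "((\<lambda>a. sqrt (2 * (a - U x))) has_real_derivative inverse (sqrt (2 * (a - U x)))) (at a)"
      using p by (auto intro!: derivative_eq_intros simp: field_simps)
    show "((\<lambda>a. inverse (sqrt (2 * (a - U x)))) has_real_derivative
        - inverse (sqrt (2 * (a - U x)) ^ 3)) (at a)"
      by (rule DERIV_cong[OF DERIV_inverse'[OF d]])
        (use p in \<open>auto simp: power3_eq_cube field_simps\<close>)
  next
    have ne: "sqrt (2 * (fst p - U (snd p))) \<noteq> 0" if "p \<in> ?S \<times> {0..r c}" for p
      using pos[of "fst p" "snd p"] that by (auto simp: mem_Times_iff)
    show "continuous_on (?S \<times> {0..r c}) (\<lambda>(a, x). sqrt (2 * (a - U x)))"
      "continuous_on (?S \<times> {0..r c}) (\<lambda>(a, x). inverse (sqrt (2 * (a - U x))))"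
      "continuous_on (?S \<times> {0..r c}) (\<lambda>(a, x). - inverse (sqrt (2 * (a - U x)) ^ 3))"
      unfolding split_beta
      by (intro continuous_intros cU ballI; use ne in simp)+
  qed
  show "twice_differentiable (\<lambda>a. integral {0..1} (\<lambda>t. t\<^sup>2 * r1 (a - (a - c) * t\<^sup>2))) ?S"
  proof (rule twice_differentiable_integral[OF S,
        where g' = "\<lambda>a t. t\<^sup>2 * (r2 (a - (a - c) * t\<^sup>2) * (1 - t\<^sup>2))"
        and g'' = "\<lambda>a t. t\<^sup>2 * (r3 (a - (a - c) * t\<^sup>2) * (1 - t\<^sup>2) * (1 - t\<^sup>2))"])
    fix a t :: real assume "a \<in> ?S" "t \<in> {0..1}"
    then have e: "a - (a - c) * t\<^sup>2 \<in> J" using between_in_J assms by auto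
    have d: "((\<lambda>a. a - (a - c) * t\<^sup>2) has_real_derivative 1 - t\<^sup>2) (at a)"
      by (auto intro!: derivative_eq_intros)
    show "((\<lambda>a. t\<^sup>2 * r1 (a - (a - c) * t\<^sup>2)) has_real_derivative
        t\<^sup>2 * (r2 (a - (a - c) * t\<^sup>2) * (1 - t\<^sup>2))) (at a)"
      by (intro DERIV_cmult DERIV_chain2[OF r1_deriv[OF e] d])
    show "((\<lambda>a. t\<^sup>2 * (r2 (a - (a - c) * t\<^sup>2) * (1 - t\<^sup>2))) has_real_derivative
        t\<^sup>2 * (r3 (a - (a - c) * t\<^sup>2) * (1 - t\<^sup>2) * (1 - t\<^sup>2))) (at a)"
      by (intro DERIV_cmult DERIV_cmult_right DERIV_chain2[OF r2_deriv[OF e] d])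
  next
    have e: "fst p - (fst p - c) * (snd p)\<^sup>2 \<in> J" if "p \<in> ?S \<times> {0..1}" for p
      using between_in_J assms that by (auto simp: mem_Times_iff)
    show "continuous_on (?S \<times> {0..1}) (\<lambda>(a, t). t\<^sup>2 * r1 (a - (a - c) * t\<^sup>2))"
      "continuous_on (?S \<times> {0..1}) (\<lambda>(a, t). t\<^sup>2 * (r2 (a - (a - c) * t\<^sup>2) * (1 - t\<^sup>2)))"
      "continuous_on (?S \<times> {0..1}) (\<lambda>(a, t). t\<^sup>2 * (r3 (a - (a - c) * t\<^sup>2) * (1 - t\<^sup>2) * (1 - t\<^sup>2)))"
      unfolding split_beta
      by (intro continuous_intros continuous_on_compose2[OF cont_r1]
          continuous_on_compose2[OF cont_r2] continuous_on_compose2[OF cont_r3]; use e in blast)+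
  qed
  show "twice_differentiable (\<lambda>a. a - c) ?S"
    unfolding twice_differentiable_def
    by (intro exI[of _ "\<lambda>_. 1"] exI[of _ "\<lambda>_. 0"]) (auto intro!: derivative_eq_intros)
  show "twice_differentiable (\<lambda>a. sqrt (2 * (a - c))) ?S"
    unfolding twice_differentiable_def
  proof (intro exI ballI conjI)
    fix a assume "a \<in> ?S"
    then have p: "0 < 2 * (a - c)" by simp
    show d: "((\<lambda>a. sqrt (2 * (a - c))) has_real_derivative inverse (sqrt (2 * (a - c)))) (at a)"
      using p by (auto intro!: derivative_eq_intros simp: field_simps)
    show "((\<lambda>a. inverse (sqrt (2 * (a - c)))) has_real_derivative
        - (inverse (sqrt (2 * (a - c))) * inverse (sqrt (2 * (a - c))) * inverse (sqrt (2 * (a - c))))) (at a)"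
      by (rule DERIV_cong[OF DERIV_inverse'[OF d]]) (use p in auto)
  qed
qed (rule twice_differentiable_const)

lemma action_derivs:
  assumes I: "\<And>a. a \<in> J \<Longrightarrow> I a = k * well_integral U a (r a)" and "a \<in> J"
  shows "(I has_real_derivative deriv I a) (at a)"
    and "(deriv I has_real_derivative deriv (deriv I) a) (at a)"
proof -
  \<comment> \<open>Every energy of the open set \<open>J\<close> has a lower one in \<open>J\<close> at which the integral can be split.\<close>
  obtain c where c: "c \<in> J" "c < a"
  proof -
    obtain e where "e > 0" "ball a e \<subseteq> J" using open_J \<open>a \<in> J\<close> openE by blast
    moreover have "a - e / 2 \<in> ball a e" using \<open>e > 0\<close> by (simp add: dist_real_def)
    ultimately have "a - e / 2 \<in> J" by blast
    then show thesis using that[of "a - e / 2"] \<open>e > 0\<close> by simp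
  qed
  let ?G = "\<lambda>a. integral {0..r c} (\<lambda>x. sqrt (2 * (a - U x))) +
    2 * (a - c) * sqrt (2 * (a - c)) * integral {0..1} (\<lambda>t. t\<^sup>2 * r1 (a - (a - c) * t\<^sup>2))"
  have td: "twice_differentiable (\<lambda>a. k * ?G a) (J \<inter> {c<..})"
    by (intro twice_differentiable_mult twice_differentiable_const
        twice_differentiable_well_integral c)
  have op: "open (J \<inter> {c<..})" using open_J by auto
  have eq: "I b = k * ?G b" if "b \<in> J \<inter> {c<..}" for b
  proof -
    have "r c < r b" "0 < r c" using that c r_strict_mono r_pos by auto
    then have "well_integral U b (r b) = integral {0..r c} (\<lambda>x. sqrt (2 * (b - U x))) +
        integral {r c..r b} (\<lambda>x. sqrt (2 * (b - U x)))"
      unfolding well_integral_def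
      by (intro Henstock_Kurzweil_Integration.integral_combine[symmetric]
          integrable_continuous_real continuous_intros cont_U) auto
    then show ?thesis using I[of b] outer_integral[of b c] that c by simp
  qed
  show "(I has_real_derivative deriv I a) (at a)"
    "(deriv I has_real_derivative deriv (deriv I) a) (at a)"
    using twice_differentiable_imp_deriv[OF td op eq] c \<open>a \<in> J\<close> by auto
qed

lemma well_integral_strict_mono:
  assumes "a \<in> J" "b \<in> J" "a < b"
  shows "well_integral U a (r a) < well_integral U b (r b)"
proof -
  have ab: "r a < r b" "0 < r a" using assms r_strict_mono r_pos by auto
  have cont: "continuous_on S (\<lambda>x. sqrt (2 * (e - U x)))" for S e
    by (intro continuous_intros cont_U)
  have "well_integral U a (r a) < integral {0..r a} (\<lambda>x. sqrt (2 * (b - U x)))"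
    unfolding well_integral_def
    by (rule integral_less_real[OF cont cont]) (use ab assms in auto)
  also have "\<dots> \<le> integral {0..r a} (\<lambda>x. sqrt (2 * (b - U x))) +
      integral {r a..r b} (\<lambda>x. sqrt (2 * (b - U x)))"
  proof -
    have "0 \<le> integral {r a..r b} (\<lambda>x. sqrt (2 * (b - U x)))"
    proof (rule integral_nonneg[OF integrable_continuous_real[OF cont]])
      fix x assume "x \<in> {r a..r b}"
      then have "U x \<le> b" using U_below[of b x] U_r[of b] assms ab by (cases "x = r b") auto
      then show "0 \<le> sqrt (2 * (b - U x))" by simp
    qed
    then show ?thesis by simp
  qed
  also have "\<dots> = well_integral U b (r b)"
    unfolding well_integral_def
    by (rule Henstock_Kurzweil_Integration.integral_combine[OF _ _ integrable_continuous_real[OF cont]])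
      (use ab in auto)
  finally show ?thesis .
qed

end

section \<open>Passage from the Hamiltonian to the potential well\<close>

lemma level_curve_of_parametrization:
  assumes U: "\<And>x. (U has_real_derivative U1 x) (at x)" "\<And>x. (U1 has_real_derivative U2 x) (at x)"
    and UV: "\<And>x. U x = V (x\<^sup>2)"
    and \<gamma>: "parametrizes \<gamma> (level_set (hamiltonian V) a)"
  obtains z w z1 w1 where "level_curve U U1 U2 a z w z1 w1"
    and "integral_w_dz \<gamma> = integral {0..1} (\<lambda>t. w t * z1 t)"
proof -
  obtain D where D: "\<And>t. (\<gamma> has_vector_derivative D t) (at t)" "continuous_on UNIV D"
    using \<gamma> unfolding parametrizes_def C1_differentiable_on_def by auto
  have vd: "vector_derivative \<gamma> (at t) = D t" for t
    by (rule vector_derivative_at[OF D(1)])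
  have comp: "((\<lambda>t. fst (\<gamma> t)) has_real_derivative fst (D t)) (at t)"
    "((\<lambda>t. snd (\<gamma> t)) has_real_derivative snd (D t)) (at t)" for t
    using bounded_linear.has_vector_derivative[OF bounded_linear_fst D(1)]
      bounded_linear.has_vector_derivative[OF bounded_linear_snd D(1)]
    by (simp_all add: has_real_derivative_iff_has_vector_derivative)
  have nz: "D t \<noteq> 0" and per: "\<gamma> (t + 1) = \<gamma> t" for t
    using \<gamma> vd unfolding parametrizes_def by auto
  have inj: "inj_on \<gamma> {0..<1}" and ran: "range \<gamma> = {p. (snd p)\<^sup>2 / 2 + U (fst p) = a}"
    using \<gamma> unfolding parametrizes_def level_set_def hamiltonian_def UV
    by (auto simp: split_beta)
  show thesis
  proof (rule that)
    show "level_curve U U1 U2 a (\<lambda>t. fst (\<gamma> t)) (\<lambda>t. snd (\<gamma> t)) (\<lambda>t. fst (D t)) (\<lambda>t. snd (D t))"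
    proof
      show "continuous_on UNIV (\<lambda>t. fst (D t))" "continuous_on UNIV (\<lambda>t. snd (D t))"
        by (intro continuous_intros D)+
      show "fst (D t) \<noteq> 0 \<or> snd (D t) \<noteq> 0" for t
        using nz[of t] by (simp add: prod_eq_iff)
      show "(snd (\<gamma> t))\<^sup>2 / 2 + U (fst (\<gamma> t)) = a" for t using ran by auto
      show "\<exists>t. fst (\<gamma> t) = x \<and> snd (\<gamma> t) = y" if "y\<^sup>2 / 2 + U x = a" for x y
      proof -
        have "(x, y) \<in> range \<gamma>" using ran that by simp
        then show ?thesis by (metis fst_conv rangeE snd_conv)
      qed
      show "s = t" if "0 \<le> s" "s < 1" "0 \<le> t" "t < 1"
        "fst (\<gamma> s) = fst (\<gamma> t)" "snd (\<gamma> s) = snd (\<gamma> t)" for s t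
        using inj_onD[OF inj, of s t] that by (simp add: prod_eq_iff)
    qed (use U comp per in \<open>simp_all add: UV\<close>)
    show "integral_w_dz \<gamma> = integral {0..1} (\<lambda>t. snd (\<gamma> t) * fst (D t))"
      by (simp add: integral_w_dz_def vd)
  qed
qed

lemma action_eq_well_integral:
  assumes U: "\<And>x. (U has_real_derivative U1 x) (at x)" "\<And>x. (U1 has_real_derivative U2 x) (at x)"
    and UV: "\<And>x. U x = V (x\<^sup>2)"
    and "regular_simple_closed_curve (level_set (hamiltonian V) a)"
  obtains r where "well_level U a r" "action (hamiltonian V) a = 2 / pi * well_integral U a r"
proof -
  let ?\<gamma> = "SOME \<gamma>. parametrizes \<gamma> (level_set (hamiltonian V) a)"
  have "parametrizes ?\<gamma> (level_set (hamiltonian V) a)"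
    using assms(4) unfolding regular_simple_closed_curve_def by (rule someI_ex)
  then obtain z w z1 w1 where curve: "level_curve U U1 U2 a z w z1 w1"
    and int: "integral_w_dz ?\<gamma> = integral {0..1} (\<lambda>t. w t * z1 t)"
    using level_curve_of_parametrization[OF U UV] by blast
  obtain r where r: "well_level U a r" using level_curve.ex_well_level[OF curve] by blast
  then show thesis
    using level_curve.curve_integral[OF curve r] int
    by (intro that[of r]) (simp_all add: action_def)
qed

lemma smooth_derivs:
  assumes "smooth f"
  shows "((deriv ^^ n) f has_real_derivative (deriv ^^ Suc n) f x) (at x)"
  using assms unfolding smooth_def differentiable_on_def
  by (simp add: DERIV_deriv_iff_real_differentiable)

text \<open>
  Continuity of the third derivative of \<open>U\<close> is what makes the third derivative of \<open>r\<close> continuous, as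
  required for differentiating twice an integrand that contains \<open>r'\<close>.
\<close>

lemma even_potential_derivs:
  assumes "smooth V"
  obtains U1 U2 U3 where "\<And>x. ((\<lambda>x. V (x\<^sup>2)) has_real_derivative U1 x) (at x)"
    "\<And>x. (U1 has_real_derivative U2 x) (at x)" "\<And>x. (U2 has_real_derivative U3 x) (at x)"
    "continuous_on UNIV U3"
proof
  let ?D = "\<lambda>n x. (deriv ^^ n) V (x\<^sup>2)"
  have D: "(?D n has_real_derivative ?D (Suc n) x * (2 * x)) (at x)" for n x
    by (rule DERIV_chain2[OF smooth_derivs[OF assms]]) (auto intro!: derivative_eq_intros)
  show "((\<lambda>x. V (x\<^sup>2)) has_real_derivative ?D 1 x * (2 * x)) (at x)" for x
    using D[of 0 x] by simp
  show "((\<lambda>x. ?D 1 x * (2 * x)) has_real_derivative ?D 2 x * (2 * x) * (2 * x) + ?D 1 x * 2) (at x)" for x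
    by (rule DERIV_cong[OF DERIV_mult[OF D DERIV_cmult[OF DERIV_ident]]]) (simp add: numeral_2_eq_2)
  let ?U3 = "\<lambda>x. ?D 3 x * (2 * x) * (2 * x) * (2 * x) + ?D 2 x * 12 * x"
  show "((\<lambda>x. ?D 2 x * (2 * x) * (2 * x) + ?D 1 x * 2) has_real_derivative ?U3 x) (at x)" for x
    by (rule DERIV_cong[OF DERIV_add[OF DERIV_mult[OF DERIV_mult[OF D DERIV_cmult[OF DERIV_ident]]
            DERIV_cmult[OF DERIV_ident]] DERIV_cmult_right[OF D]]])
      (simp add: numeral_2_eq_2 numeral_3_eq_3 algebra_simps)
  have "continuous_on UNIV (?D n)" for n
    by (rule DERIV_continuous_on) (rule D)
  then show "continuous_on UNIV ?U3" by (intro continuous_intros)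
qed

lemma action_properties:
  assumes "smooth V" "open J" "convex J"
    and "\<forall>a\<in>J. regular_simple_closed_curve (level_set (hamiltonian V) a)"
  defines "I \<equiv> action (hamiltonian V)"
  shows "strict_mono_on J I"
    and "\<And>a. a \<in> J \<Longrightarrow> (I has_real_derivative deriv I a) (at a)"
    and "\<And>a. a \<in> J \<Longrightarrow> (deriv I has_real_derivative deriv (deriv I) a) (at a)"
proof -
  let ?U = "\<lambda>x. V (x\<^sup>2)"
  obtain U1 U2 U3 where U: "\<And>x. (?U has_real_derivative U1 x) (at x)"
    "\<And>x. (U1 has_real_derivative U2 x) (at x)" "\<And>x. (U2 has_real_derivative U3 x) (at x)"
    "continuous_on UNIV U3"
    using even_potential_derivs[OF assms(1)] by blast
  have "\<exists>r. well_level ?U a r \<and> I a = 2 / pi * well_integral ?U a r" if "a \<in> J" for a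
    unfolding I_def
    by (rule action_eq_well_integral[OF U(1,2) refl, of a]) (use assms(4) that in blast)+
  then obtain r where r: "\<And>a. a \<in> J \<Longrightarrow> well_level ?U a (r a)"
    and I: "\<And>a. a \<in> J \<Longrightarrow> I a = 2 / pi * well_integral ?U a (r a)"
    by metis
  interpret well_family ?U U1 U2 U3 J r
    by standard (use U r assms(2,3) in auto)
  show "strict_mono_on J I"
    by (rule strict_mono_onI)
      (simp add: I well_integral_strict_mono divide_strict_right_mono)
  show "(I has_real_derivative deriv I a) (at a)"
    "(deriv I has_real_derivative deriv (deriv I) a) (at a)" if "a \<in> J" for a
    using action_derivs[OF I that] by auto
qed

section \<open>Convexity of one action as a function of the other\<close>

text \<open>
  For \<open>x = F p\<close>, \<open>y = F q\<close> let \<open>c\<close> be the preimage of \<open>(1 - t) x + t y\<close>. Convexity of \<open>F\<close> puts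
  \<open>(1 - t) p + t q\<close> on the left of \<open>c\<close>; hence \<open>m - c\<close> lies on the left of the corresponding combination of
  \<open>m - p\<close> and \<open>m - q\<close>, and monotonicity followed by convexity of \<open>G\<close> finishes. The point
  \<open>c\<close> exists because \<open>F\<close> is continuous.
\<close>

lemma convex_on_composed_inverse:
  fixes F G \<phi> :: "real \<Rightarrow> real"
  assumes J: "convex J" and F: "strict_mono_on J F" "convex_on J F" "continuous_on J F"
    and G: "mono_on ((-) m ` J) G" "convex_on ((-) m ` J) G"
    and \<phi>: "\<And>a. a \<in> J \<Longrightarrow> \<phi> (F a) = G (m - a)"
  shows "convex_on (F ` J) \<phi>"
proof (rule convex_onI)
  have "connected (F ` J)"
    using F(3) convex_connected[OF J] by (rule connected_continuous_image)
  then show cF: "convex (F ` J)" by (simp add: is_interval_convex_1[symmetric] is_interval_connected_1)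
  fix t x y :: real
  assume t: "0 < t" "t < 1" and "x \<in> F ` J" "y \<in> F ` J"
  then obtain p q where pq: "p \<in> J" "q \<in> J" "x = F p" "y = F q" by auto
  have "(1 - t) *\<^sub>R x + t *\<^sub>R y \<in> F ` J"
    by (rule convexD[OF cF]) (use t pq in auto)
  then obtain c where c: "c \<in> J" "(1 - t) *\<^sub>R x + t *\<^sub>R y = F c" by auto
  let ?d = "(1 - t) *\<^sub>R p + t *\<^sub>R q"
  have d: "?d \<in> J" by (rule convexD[OF J]) (use t pq in auto)
  have "F ?d \<le> F c"
    using convex_onD[OF F(2), of t p q] t pq c by simp
  then have "?d \<le> c"
    using strict_mono_onD[OF F(1) c(1) d] by fastforce
  then have "G (m - c) \<le> G (m - ?d)"
    by (intro mono_onD[OF G(1)]) (use c d in auto)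
  also have "m - ?d = (1 - t) *\<^sub>R (m - p) + t *\<^sub>R (m - q)"
    by (simp add: algebra_simps)
  also have "G \<dots> \<le> (1 - t) * G (m - p) + t * G (m - q)"
    using convex_onD[OF G(2), of t "m - p" "m - q"] t pq by auto
  finally show "\<phi> ((1 - t) *\<^sub>R x + t *\<^sub>R y) \<le> (1 - t) * \<phi> x + t * \<phi> y"
    using \<phi> c pq by simp
qed

lemma convex_on_reflect:
  fixes f :: "real \<Rightarrow> real"
  assumes "convex_on S f"
  shows "convex_on (uminus ` S) (\<lambda>x. f (- x))"
proof (rule convex_onI)
  show "convex (uminus ` S)"
    using assms by (intro convex_negations) (rule convex_on_imp_convex)
  fix t x y :: real
  assume "0 < t" "t < 1" "x \<in> uminus ` S" "y \<in> uminus ` S"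
  then show "f (- ((1 - t) *\<^sub>R x + t *\<^sub>R y)) \<le> (1 - t) * f (- x) + t * f (- y)"
    using convex_onD[OF assms, of t "- x" "- y"] by auto
qed

text \<open>
  The point reflections \<open>a \<mapsto> - F (- a)\<close>, \<open>b \<mapsto> - G (- b)\<close> and \<open>x \<mapsto> - \<phi> (- x)\<close> turn concave into convex
  functions and preserve monotonicity, with \<open>m\<close> replaced by \<open>- m\<close>.
\<close>

lemma concave_on_composed_inverse:
  fixes F G \<phi> :: "real \<Rightarrow> real"
  assumes J: "convex J" and F: "strict_mono_on J F" "concave_on J F" "continuous_on J F"
    and G: "mono_on ((-) m ` J) G" "concave_on ((-) m ` J) G"
    and \<phi>: "\<And>a. a \<in> J \<Longrightarrow> \<phi> (F a) = G (m - a)"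
  shows "concave_on (F ` J) \<phi>"
proof -
  have set: "(-) (- m) ` uminus ` J = uminus ` (-) m ` J"
    by (auto simp: image_iff)
  have "convex_on ((\<lambda>a. - F (- a)) ` uminus ` J) (\<lambda>x. - \<phi> (- x))"
  proof (rule convex_on_composed_inverse[where m = "- m" and G = "\<lambda>b. - G (- b)"])
    show "convex (uminus ` J)" using J by (rule convex_negations)
    show "strict_mono_on (uminus ` J) (\<lambda>a. - F (- a))"
      using F(1) by (auto simp: strict_mono_on_def)
    show "convex_on (uminus ` J) (\<lambda>a. - F (- a))"
      using F(2) unfolding concave_on_def by (rule convex_on_reflect)
    show "continuous_on (uminus ` J) (\<lambda>a. - F (- a))"
      by (intro continuous_intros continuous_on_compose2[OF F(3)]) auto
    show "mono_on ((-) (- m) ` uminus ` J) (\<lambda>b. - G (- b))"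
      using G(1) unfolding set by (auto simp: monotone_on_def)
    show "convex_on ((-) (- m) ` uminus ` J) (\<lambda>b. - G (- b))"
      using G(2) unfolding set concave_on_def by (rule convex_on_reflect)
  qed (use \<phi> in auto)
  from convex_on_reflect[OF this] show ?thesis
    by (simp add: concave_on_def image_image)
qed

theorem mainTheorem6:
  fixes V1 V2 :: "real \<Rightarrow> real" and m :: real and J :: "real set"
    and K1 K2 :: "real \<times> real \<Rightarrow> real" and I1 I2 :: "real \<Rightarrow> real"
  assumes "smooth V1" and "smooth V2"
    and "K1 = hamiltonian V1" and "K2 = hamiltonian V2"
    and "open J" and "is_interval J"
    and "\<forall>a\<in>J. regular_simple_closed_curve (level_set K1 a) \<and>
                regular_simple_closed_curve (level_set K2 (m - a))"
    and "I1 = action K1" and "I2 = action K2"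
  shows "\<exists>\<phi>. (\<forall>a\<in>J. \<phi> (I1 a) = I2 (m - a)) \<and>
    ((\<forall>a\<in>J. deriv (deriv I1) a > 0) \<and> (\<forall>b\<in>(\<lambda>a. m - a) ` J. deriv (deriv I2) b > 0)
       \<longrightarrow> convex_on (I1 ` J) \<phi>) \<and>
    ((\<forall>a\<in>J. deriv (deriv I1) a < 0) \<and> (\<forall>b\<in>(\<lambda>a. m - a) ` J. deriv (deriv I2) b < 0)
       \<longrightarrow> concave_on (I1 ` J) \<phi>)"
proof -
  define J' where "J' = (\<lambda>a. m - a) ` J"
  have conv: "convex J" using assms(6) by (simp add: is_interval_convex_1)
  have "J' = (+) m ` uminus ` J" by (auto simp: J'_def image_image)
  then have J': "open J'" "convex J'"
    using assms(5) conv by (auto intro: open_translation open_negations convex_negations)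
  have curves: "\<forall>a\<in>J. regular_simple_closed_curve (level_set (hamiltonian V1) a)"
    "\<forall>b\<in>J'. regular_simple_closed_curve (level_set (hamiltonian V2) b)"
    using assms(3,4,7) by (auto simp: J'_def)
  note I1 = action_properties[OF assms(1,5) conv curves(1), folded assms(3), folded assms(8)]
  note I2 = action_properties[OF assms(2) J' curves(2), folded assms(4), folded assms(9)]
  define \<phi> where "\<phi> = (\<lambda>x. I2 (m - the_inv_into J I1 x))"
  have \<phi>: "\<phi> (I1 a) = I2 (m - a)" if "a \<in> J" for a
    using the_inv_into_f_f[OF strict_mono_on_imp_inj_on[OF I1(1)] that] by (simp add: \<phi>_def)
  have cont: "continuous_on J I1"
    by (rule DERIV_continuous_on) (rule has_field_derivative_at_within[OF I1(2)])
  have mono: "mono_on J' I2" using I2(1) by (rule strict_mono_on_imp_mono_on)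
  have "convex_on (I1 ` J) \<phi>"
    if "\<forall>a\<in>J. deriv (deriv I1) a > 0" "\<forall>b\<in>J'. deriv (deriv I2) b > 0"
  proof (rule convex_on_composed_inverse[OF conv I1(1) _ cont])
    show "convex_on J I1"
      by (rule f''_ge0_imp_convex[OF conv I1(2,3)]) (use that in force)+
    show "convex_on ((-) m ` J) I2"
      unfolding J'_def[symmetric]
      by (rule f''_ge0_imp_convex[OF J'(2) I2(2,3)]) (use that in force)+
  qed (use mono \<phi> in \<open>auto simp: J'_def\<close>)
  moreover have "concave_on (I1 ` J) \<phi>"
    if "\<forall>a\<in>J. deriv (deriv I1) a < 0" "\<forall>b\<in>J'. deriv (deriv I2) b < 0"
  proof (rule concave_on_composed_inverse[OF conv I1(1) _ cont])
    show "concave_on J I1"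
      by (rule f''_le0_imp_concave[OF conv I1(2,3)]) (use that in force)+
    show "concave_on ((-) m ` J) I2"
      unfolding J'_def[symmetric]
      by (rule f''_le0_imp_concave[OF J'(2) I2(2,3)]) (use that in force)+
  qed (use mono \<phi> in \<open>auto simp: J'_def\<close>)
  ultimately show ?thesis using \<phi> unfolding J'_def by blast
qed

end
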